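(* For every well-typed iso $\vdash_\omega\omega:A\leftrightarrow B$ and every well-typed closed value $\vdash_e v:B$, if $\omega\,(\omega^\perp\,v)\to^* v'$ with $v'$ a value, then $v=v'$.
   Context: Types: $A,B ::= \mathbb{1} \mid A\oplus B \mid A\otimes B \mid \mu X.A \mid X$ ($\mu$ binds $X$; only closed types are used; $A[X\leftarrow C]$ is substitution). Iso types: $\alpha ::= A\leftrightarrow B$. Syntax: values $v ::= () \mid x \mid \mathtt{inl}\,v \mid \mathtt{inr}\,v \mid \langle v_1,v_2\rangle \mid \mathtt{fold}\,v$; patterns $p ::= x \mid \langle p_1,p_2\rangle$; expressions $e ::= v \mid \mathtt{let}\,p_1=\omega\,p_2\,\mathtt{in}\,e$; isos $\omega ::= \{v_1\leftrightarrow e_1\mid\dots\mid v_n\leftrightarrow e_n\} \mid \mathtt{fix}\,f.\omega \mid f$ ($f$ an iso-variable); terms $t ::= () \mid x \mid \mathtt{inl}\,t\mid\mathtt{inr}\,t\mid\langle t_1,t_2\rangle\mid\mathtt{fold}\,t\mid \omega\,t\mid \mathtt{let}\,p=t_1\,\mathtt{in}\,t_2$. $(x_1,\dots,x_n)$ abbreviates $\langle x_1,\langle\dots,x_n\rangle\rangle$ and $A_1\otimes\dots\otimes A_n$ is right-nested. Terms are taken up to $\alpha$-conversion with all bound and free variable names distinct. Typing of terms $\Delta;\Psi\vdash_e t:A$, where $\Delta$ is a set of pairs $x:A$ (each variable at most once) and $\Psi$ is empty or a single pair $f:\alpha$: $\emptyset;\Psi\vdash_e():\mathbb{1}$; $x:A;\Psi\vdash_e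 x:A$; from $\Delta;\Psi\vdash_e t:A$ infer $\Delta;\Psi\vdash_e\mathtt{inl}\,t:A\oplus B$; from $\Delta;\Psi\vdash_e t:B$ infer $\Delta;\Psi\vdash_e\mathtt{inr}\,t:A\oplus B$; from $\Delta_1;\Psi\vdash_e t_1:A$ and $\Delta_2;\Psi\vdash_e t_2:B$ infer $\Delta_1,\Delta_2;\Psi\vdash_e\langle t_1,t_2\rangle:A\otimes B$; from $\Delta;\Psi\vdash_e t:A[X\leftarrow\mu X.A]$ infer $\Delta;\Psi\vdash_e\mathtt{fold}\,t:\mu X.A$; from $\Psi\vdash_\omega f:A\leftrightarrow B$ and $\Delta;\Psi\vdash_e t:A$ infer $\Delta;\Psi\vdash_e f\,t:B$; from $\vdash_\omega\omega:A\leftrightarrow B$ (empty iso-context) and $\Delta;\Psi\vdash_e t:A$ infer $\Delta;\Psi\vdash_e\omega\,t:B$; from $\Delta_1;\Psi\vdash_e t_1:A_1\otimes\dots\otimes A_n$ and $\Delta_2,x_1:A_1,\dots,x_n:A_n;\Psi\vdash_e t_2:B$ infer $\Delta_1,\Delta_2;\Psi\vdash_e\mathtt{let}\,(x_1,\dots,x_n)=t_1\,\mathtt{in}\,t_2:B$. $\vdash_e t:A$ means both contexts are empty. Typing of isos $\Psi\vdash_\omega\omega:\alpha$: (i) if for each $i$, $\Delta_i\vdash_e v_i:A$ and $\Delta_i;\Psi\vdash_e e_i:B$, and $\mathtt{OD}_A(\{v_1,\dots,v_n\})$ and $\mathtt{OD}_B(\{Val(e_1),\dots,Val(e_n)\})$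 hold, then $\Psi\vdash_\omega\{v_1\leftrightarrow e_1\mid\dots\mid v_n\leftrightarrow e_n\}:A\leftrightarrow B$, where $Val(\mathtt{let}\,p=\omega\,p'\,\mathtt{in}\,e)=Val(e)$ and $Val(v)=v$; (ii) $f:\alpha\vdash_\omega f:\alpha$; (iii) if $f:\alpha\vdash_\omega\omega:\alpha$ and $\mathtt{fix}\,f.\omega$ is structurally recursive, then $\Psi\vdash_\omega\mathtt{fix}\,f.\omega:\alpha$. Structural recursion: $\mathtt{fix}\,f.\{v_1\leftrightarrow e_1\mid\dots\mid v_n\leftrightarrow e_n\}:A_1\otimes\dots\otimes A_m\leftrightarrow C$ is structurally recursive if there is $1\le j\le m$ with $A_j=\mu X.B$ such that for each $i$, $v_i=(v_i^1,\dots,v_i^m)$ and either $v_i^j$ is closed and $e_i$ contains no subterm $f\,p$, or $v_i^j$ is open and every subterm $f\,p$ of $e_i$ has $p=(x_1,\dots,x_m)$ with $x_j:\mu X.B$ a strict subterm of $v_i^j$. $\mathtt{OD}_A(S)$ is defined inductively: $\mathtt{OD}_A(\{x\})$; $\mathtt{OD}_{\mathbb{1}}(\{()\})$; if $\mathtt{OD}_A(S)$ and $\mathtt{OD}_B(T)$ then $\mathtt{OD}_{A\oplus B}(\{\mathtt{inl}\,v\mid v\in S\}\cup\{\mathtt{inr}\,v\mid v\in T\})$; if $\mathtt{OD}_{A[X\leftarrow\mu X.A]}(S)$ then $\mathtt{OD}_{\mu X.A}(\{\mathtt{fold}\,v\mid v\in S\})$; for a set $S$ of pairs, $\mathtt{OD}_{A\otimes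 B}(S)$ if either ($\mathtt{OD}_A(\pi_1 S)$ and $\forall v\in\pi_1 S$, $\mathtt{OD}_B(\{w\mid\langle v,w\rangle\in S\})$) or ($\mathtt{OD}_B(\pi_2 S)$ and $\forall v\in\pi_2 S$, $\mathtt{OD}_A(\{w\mid\langle w,v\rangle\in S\})$), with $\pi_1 S=\{v\mid\langle v,w\rangle\in S\}$, $\pi_2 S=\{w\mid\langle v,w\rangle\in S\}$. Substitutions $\sigma$ map variables to values; $\sigma(t)$ replaces each $x$ with $(x\mapsto v)\in\sigma$ by $v$ (homomorphically, not capturing let-bound variables). Pattern matching $\sigma[v]=v'$: $\sigma[x]=e$ when $\sigma=\{x\mapsto e\}$; $\sigma[()]=()$; $\sigma[\mathtt{inl}\,e]=\mathtt{inl}\,e'$ if $\sigma[e]=e'$, similarly for $\mathtt{inr}$, $\mathtt{fold}$; $\sigma[\langle e_1,e_2\rangle]=\langle e_1',e_2'\rangle$ if $\sigma_1[e_1]=e_1'$, $\sigma_2[e_2]=e_2'$, $\sigma_1,\sigma_2$ have disjoint supports and $\sigma=\sigma_1\cup\sigma_2$. Evaluation contexts: $C ::= [\,] \mid \mathtt{inl}\,C\mid\mathtt{inr}\,C\mid\omega\,C\mid\mathtt{let}\,p=C\,\mathtt{in}\,t\mid\langle C,v\rangle\mid\langle v,C\rangle\mid\mathtt{fold}\,C\mid C\,t$. Reduction $\to$: if $t_1\to t_2$ then $C[t_1]\to C[t_2]$; $\mathtt{let}\,p=v\,\mathtt{in}\,t\to\sigma(t)$ if $\sigma[p]=v$; $\mathtt{fix}\,f.\omega\to\omega[f:=\mathtt{fix}\,f.\omega]$;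 $\{v_1\leftrightarrow e_1\mid\dots\mid v_n\leftrightarrow e_n\}\,v'\to\sigma(e_i)$ if $\sigma[v_i]=v'$. $\to^*$ is the reflexive transitive closure. Inversion: $f^\perp=f$; $(\mathtt{fix}\,f.\omega)^\perp=\mathtt{fix}\,f.\omega^\perp$; $\{(v_i\leftrightarrow e_i)_{i\in I}\}^\perp=\{((v_i\leftrightarrow e_i)^\perp)_{i\in I}\}$, where for a clause $v_1\leftrightarrow \mathtt{let}\,p_1=\omega_1\,p_1'\,\mathtt{in}\cdots\mathtt{let}\,p_n=\omega_n\,p_n'\,\mathtt{in}\,v_1'$ its inverse is $v_1'\leftrightarrow\mathtt{let}\,p_n'=\omega_n^\perp\,p_n\,\mathtt{in}\cdots\mathtt{let}\,p_1'=\omega_1^\perp\,p_1\,\mathtt{in}\,v_1$. *)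

theory Defs
  imports Main
begin

section \<open>Types\<close>

text \<open>Types are considered up to renaming of the variables bound by \<open>\<mu>\<close>, hence de Bruijn indices.\<close>

datatype ty =
    TUnit
  | TSum ty ty (infixr "\<oplus>" 65)
  | TProd ty ty (infixr "\<otimes>" 70)
  | TMu ty
  | TVar nat

primrec ty_lift :: "nat \<Rightarrow> ty \<Rightarrow> ty" where
  "ty_lift k TUnit = TUnit"
| "ty_lift k (A \<oplus> B) = ty_lift k A \<oplus> ty_lift k B"
| "ty_lift k (A \<otimes> B) = ty_lift k A \<otimes> ty_lift k B"
| "ty_lift k (TMu A) = TMu (ty_lift (Suc k) A)"
| "ty_lift k (TVar n) = TVar (if n < k then n else Suc n)"

primrec ty_subst :: "nat \<Rightarrow> ty \<Rightarrow> ty \<Rightarrow> ty" where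
  "ty_subst k C TUnit = TUnit"
| "ty_subst k C (A \<oplus> B) = ty_subst k C A \<oplus> ty_subst k C B"
| "ty_subst k C (A \<otimes> B) = ty_subst k C A \<otimes> ty_subst k C B"
| "ty_subst k C (TMu A) = TMu (ty_subst (Suc k) (ty_lift 0 C) A)"
| "ty_subst k C (TVar n) = (if n < k then TVar n else if n = k then C else TVar (n - 1))"

text \<open>\<open>unfold_mu A\<close> is \<open>A[X \<leftarrow> \<mu>X. A]\<close>.\<close>

definition unfold_mu :: "ty \<Rightarrow> ty" where
  "unfold_mu A = ty_subst 0 (TMu A) A"

primrec closed_at :: "nat \<Rightarrow> ty \<Rightarrow> bool" where
  "closed_at k TUnit = True"
| "closed_at k (A \<oplus> B) = (closed_at k A \<and> closed_at k B)"
| "closed_at k (A \<otimes> B) = (closed_at k A \<and> closed_at k B)"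
| "closed_at k (TMu A) = closed_at (Suc k) A"
| "closed_at k (TVar n) = (n < k)"

definition closed_ty :: "ty \<Rightarrow> bool" where
  "closed_ty A = closed_at 0 A"

datatype isoty = IsoTy ty ty (infix "\<leftrightarrow>" 60)


section \<open>Terms\<close>

type_synonym var = string
type_synonym ivar = string

datatype val =
    VUnit
  | VVar var
  | VInl val
  | VInr val
  | VPair val val
  | VFold val

datatype pat =
    PVar var
  | PPair pat pat

text \<open>\<open>ELet p \<omega> p' e\<close> is \<open>let p = \<omega> p' in e\<close>. In a clause \<open>(v, e)\<close> the variables of \<open>v\<close> are bound
  in \<open>e\<close>, so an iso has no free term variables.\<close>

datatype iso =
    Clauses "(val \<times> exp) list"
  | Fix ivar iso
  | IVar ivar
and exp =
    EVal val
  | ELet pat iso pat exp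

datatype trm =
    TmUnit
  | TmVar var
  | TmInl trm
  | TmInr trm
  | TmPair trm trm
  | TmFold trm
  | TmApp iso trm
  | TmLet pat trm trm

primrec val_of_pat :: "pat \<Rightarrow> val" where
  "val_of_pat (PVar x) = VVar x"
| "val_of_pat (PPair p q) = VPair (val_of_pat p) (val_of_pat q)"

primrec trm_of_val :: "val \<Rightarrow> trm" where
  "trm_of_val VUnit = TmUnit"
| "trm_of_val (VVar x) = TmVar x"
| "trm_of_val (VInl v) = TmInl (trm_of_val v)"
| "trm_of_val (VInr v) = TmInr (trm_of_val v)"
| "trm_of_val (VPair v w) = TmPair (trm_of_val v) (trm_of_val w)"
| "trm_of_val (VFold v) = TmFold (trm_of_val v)"

fun trm_of_exp :: "exp \<Rightarrow> trm" where
  "trm_of_exp (EVal v) = trm_of_val v"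
| "trm_of_exp (ELet p \<omega> p' e) = TmLet p (TmApp \<omega> (trm_of_val (val_of_pat p'))) (trm_of_exp e)"

primrec pat_vars :: "pat \<Rightarrow> var set" where
  "pat_vars (PVar x) = {x}"
| "pat_vars (PPair p q) = pat_vars p \<union> pat_vars q"

primrec val_vars :: "val \<Rightarrow> var set" where
  "val_vars VUnit = {}"
| "val_vars (VVar x) = {x}"
| "val_vars (VInl v) = val_vars v"
| "val_vars (VInr v) = val_vars v"
| "val_vars (VPair v w) = val_vars v \<union> val_vars w"
| "val_vars (VFold v) = val_vars v"

primrec subvals :: "val \<Rightarrow> val set" where
  "subvals VUnit = {VUnit}"
| "subvals (VVar x) = {VVar x}"
| "subvals (VInl v) = insert (VInl v) (subvals v)"
| "subvals (VInr v) = insert (VInr v) (subvals v)"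
| "subvals (VPair v w) = insert (VPair v w) (subvals v \<union> subvals w)"
| "subvals (VFold v) = insert (VFold v) (subvals v)"

fun exp_val :: "exp \<Rightarrow> val" where
  "exp_val (EVal v) = v"
| "exp_val (ELet p \<omega> p' e) = exp_val e"

text \<open>Right-nested tuples and tensors: \<open>rnest c [a\<^sub>1, \<dots>, a\<^sub>n] = c a\<^sub>1 (c a\<^sub>2 (\<dots> a\<^sub>n))\<close>; used for
  non-empty lists only.\<close>

fun rnest :: "('a \<Rightarrow> 'a \<Rightarrow> 'a) \<Rightarrow> 'a list \<Rightarrow> 'a" where
  "rnest c [a] = a"
| "rnest c (a # b # as) = c a (rnest c (b # as))"


section \<open>Orthogonal decomposition\<close>

inductive OD :: "ty \<Rightarrow> val set \<Rightarrow> bool" where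
  OD_var: "OD A {VVar x}"
| OD_unit: "OD TUnit {VUnit}"
| OD_sum: "OD A S \<Longrightarrow> OD B T \<Longrightarrow> OD (A \<oplus> B) (VInl ` S \<union> VInr ` T)"
| OD_fold: "OD (unfold_mu A) S \<Longrightarrow> OD (TMu A) (VFold ` S)"
| OD_prod1: "S \<subseteq> {VPair v w | v w. True} \<Longrightarrow> OD A {v. \<exists>w. VPair v w \<in> S} \<Longrightarrow>
    \<forall>v \<in> {v. \<exists>w. VPair v w \<in> S}. OD B {w. VPair v w \<in> S} \<Longrightarrow> OD (A \<otimes> B) S"
| OD_prod2: "S \<subseteq> {VPair v w | v w. True} \<Longrightarrow> OD B {w. \<exists>v. VPair v w \<in> S} \<Longrightarrow>
    \<forall>v \<in> {w. \<exists>v. VPair v w \<in> S}. OD A {w. VPair w v \<in> S} \<Longrightarrow> OD (A \<otimes> B) S"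

text \<open>In \<open>OD\<^sub>A({v\<^sub>1, \<dots>, v\<^sub>n})\<close> for a list of clauses, \<open>v\<^sub>1, \<dots>, v\<^sub>n\<close> enumerates the set without
  repetition. If repetitions could collapse, \<open>{() \<leftrightarrow> inl () | () \<leftrightarrow> inr ()}\<close> would be a well-typed
  but non-deterministic iso.\<close>

definition OD_list :: "ty \<Rightarrow> val list \<Rightarrow> bool" where
  "OD_list A vs \<longleftrightarrow> distinct vs \<and> OD A (set vs)"


section \<open>Structural recursion\<close>

text \<open>The subterms \<open>f p\<close> of an expression, each paired with the let-bound variables in whose scope
  it lies. The inner isos need not be searched: those of a well-typed expression are
  either \<open>f\<close> itself or closed.\<close>

fun calls :: "ivar \<Rightarrow> exp \<Rightarrow> (var set \<times> pat) set" where
  "calls f (EVal v) = {}"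
| "calls f (ELet p \<omega> p' e) =
    (if \<omega> = IVar f then {({}, p')} else {}) \<union> {(pat_vars p \<union> X, q) | X q. (X, q) \<in> calls f e}"

text \<open>\<open>xs ! j \<notin> X\<close> says that the variable is the one of the clause's left-hand side and not
  a let-bound variable of the same name. That it has type \<open>As ! j\<close> follows from the typing of
  \<open>f p\<close>. The index \<open>j\<close> counts from 0.\<close>

definition clause_decreasing :: "ivar \<Rightarrow> nat \<Rightarrow> nat \<Rightarrow> val \<Rightarrow> exp \<Rightarrow> bool" where
  "clause_decreasing f m j v e \<longleftrightarrow>
    (\<exists>vs. length vs = m \<and> v = rnest VPair vs \<and>
      (val_vars (vs ! j) = {} \<and> calls f e = {} \<or>
       val_vars (vs ! j) \<noteq> {} \<and>
       (\<forall>(X, p) \<in> calls f e. \<exists>xs. length xs = m \<and> p = rnest PPair (map PVar xs) \<and>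
          xs ! j \<notin> X \<and> VVar (xs ! j) \<in> subvals (vs ! j) \<and> VVar (xs ! j) \<noteq> vs ! j)))"

definition structurally_recursive :: "ivar \<Rightarrow> iso \<Rightarrow> isoty \<Rightarrow> bool" where
  "structurally_recursive f \<omega> \<alpha> \<longleftrightarrow>
    (\<exists>cs As C j B. \<omega> = Clauses cs \<and> \<alpha> = (rnest TProd As \<leftrightarrow> C) \<and> j < length As \<and> As ! j = TMu B \<and>
      (\<forall>(v, e) \<in> set cs. clause_decreasing f (length As) j v e))"


section \<open>Typing\<close>

text \<open>Term contexts are finite partial maps and contain exactly the free variables of the term
  (linearity). Only closed types are used, so the rules that introduce a type ask for closedness.\<close>

inductive trm_typing :: "(var \<rightharpoonup> ty) \<Rightarrow> (ivar \<times> isoty) option \<Rightarrow> trm \<Rightarrow> ty \<Rightarrow> bool"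
  and iso_typing :: "(ivar \<times> isoty) option \<Rightarrow> iso \<Rightarrow> isoty \<Rightarrow> bool"
where
  T_Unit: "trm_typing Map.empty \<Psi> TmUnit TUnit"
| T_Var: "closed_ty A \<Longrightarrow> trm_typing [x \<mapsto> A] \<Psi> (TmVar x) A"
| T_Inl: "trm_typing \<Delta> \<Psi> t A \<Longrightarrow> closed_ty B \<Longrightarrow> trm_typing \<Delta> \<Psi> (TmInl t) (A \<oplus> B)"
| T_Inr: "trm_typing \<Delta> \<Psi> t B \<Longrightarrow> closed_ty A \<Longrightarrow> trm_typing \<Delta> \<Psi> (TmInr t) (A \<oplus> B)"
| T_Pair: "trm_typing \<Delta>\<^sub>1 \<Psi> t\<^sub>1 A \<Longrightarrow> trm_typing \<Delta>\<^sub>2 \<Psi> t\<^sub>2 B \<Longrightarrow> dom \<Delta>\<^sub>1 \<inter> dom \<Delta>\<^sub>2 = {} \<Longrightarrow>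
    trm_typing (\<Delta>\<^sub>1 ++ \<Delta>\<^sub>2) \<Psi> (TmPair t\<^sub>1 t\<^sub>2) (A \<otimes> B)"
| T_Fold: "trm_typing \<Delta> \<Psi> t (unfold_mu A) \<Longrightarrow> closed_ty (TMu A) \<Longrightarrow> trm_typing \<Delta> \<Psi> (TmFold t) (TMu A)"
| T_AppVar: "iso_typing \<Psi> (IVar f) (A \<leftrightarrow> B) \<Longrightarrow> trm_typing \<Delta> \<Psi> t A \<Longrightarrow> trm_typing \<Delta> \<Psi> (TmApp (IVar f) t) B"
| T_App: "iso_typing None \<omega> (A \<leftrightarrow> B) \<Longrightarrow> trm_typing \<Delta> \<Psi> t A \<Longrightarrow> trm_typing \<Delta> \<Psi> (TmApp \<omega> t) B"
| T_Let: "trm_typing \<Delta>\<^sub>1 \<Psi> t\<^sub>1 (rnest TProd As) \<Longrightarrow>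
    xs \<noteq> [] \<Longrightarrow> length xs = length As \<Longrightarrow> distinct xs \<Longrightarrow> set xs \<inter> dom \<Delta>\<^sub>2 = {} \<Longrightarrow>
    trm_typing (\<Delta>\<^sub>2 ++ map_of (zip xs As)) \<Psi> t\<^sub>2 B \<Longrightarrow> dom \<Delta>\<^sub>1 \<inter> dom \<Delta>\<^sub>2 = {} \<Longrightarrow>
    trm_typing (\<Delta>\<^sub>1 ++ \<Delta>\<^sub>2) \<Psi> (TmLet (rnest PPair (map PVar xs)) t\<^sub>1 t\<^sub>2) B"
| I_Clauses: "closed_ty A \<Longrightarrow> closed_ty B \<Longrightarrow>
    \<forall>v e. (v, e) \<in> set cs \<longrightarrow> (\<exists>\<Delta>. trm_typing \<Delta> None (trm_of_val v) A \<and> trm_typing \<Delta> \<Psi> (trm_of_exp e) B) \<Longrightarrow>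
    OD_list A (map fst cs) \<Longrightarrow> OD_list B (map (exp_val \<circ> snd) cs) \<Longrightarrow>
    iso_typing \<Psi> (Clauses cs) (A \<leftrightarrow> B)"
| I_Var: "closed_ty A \<Longrightarrow> closed_ty B \<Longrightarrow> iso_typing (Some (f, A \<leftrightarrow> B)) (IVar f) (A \<leftrightarrow> B)"
| I_Fix: "iso_typing (Some (f, \<alpha>)) \<omega> \<alpha> \<Longrightarrow> structurally_recursive f \<omega> \<alpha> \<Longrightarrow> iso_typing \<Psi> (Fix f \<omega>) \<alpha>"


section \<open>Substitution and pattern matching\<close>

text \<open>Substitutions do not rename binders: reduction of a closed term only ever substitutes
  closed values and closed isos. Isos have no free term variables, so \<open>subst\<close> leaves them alone.\<close>

primrec subst :: "(var \<rightharpoonup> val) \<Rightarrow> trm \<Rightarrow> trm" where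
  "subst \<sigma> TmUnit = TmUnit"
| "subst \<sigma> (TmVar x) = (case \<sigma> x of None \<Rightarrow> TmVar x | Some v \<Rightarrow> trm_of_val v)"
| "subst \<sigma> (TmInl t) = TmInl (subst \<sigma> t)"
| "subst \<sigma> (TmInr t) = TmInr (subst \<sigma> t)"
| "subst \<sigma> (TmPair s t) = TmPair (subst \<sigma> s) (subst \<sigma> t)"
| "subst \<sigma> (TmFold t) = TmFold (subst \<sigma> t)"
| "subst \<sigma> (TmApp \<omega> t) = TmApp \<omega> (subst \<sigma> t)"
| "subst \<sigma> (TmLet p s t) = TmLet p (subst \<sigma> s) (subst (\<sigma> |` (- pat_vars p)) t)"

text \<open>\<open>isubst f \<phi> \<omega>\<close> is \<open>\<omega>[f := \<phi>]\<close>.\<close>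

fun isubst :: "ivar \<Rightarrow> iso \<Rightarrow> iso \<Rightarrow> iso"
  and isubst_exp :: "ivar \<Rightarrow> iso \<Rightarrow> exp \<Rightarrow> exp"
where
  "isubst f \<phi> (Clauses cs) = Clauses (map (\<lambda>(v, e). (v, isubst_exp f \<phi> e)) cs)"
| "isubst f \<phi> (Fix g \<omega>) = Fix g (if g = f then \<omega> else isubst f \<phi> \<omega>)"
| "isubst f \<phi> (IVar g) = (if g = f then \<phi> else IVar g)"
| "isubst_exp f \<phi> (EVal v) = EVal v"
| "isubst_exp f \<phi> (ELet p \<omega> p' e) = ELet p (isubst f \<phi> \<omega>) p' (isubst_exp f \<phi> e)"

text \<open>\<open>match \<sigma> v v'\<close> is \<open>\<sigma>[v] = v'\<close>; the support of \<open>\<sigma>\<close> is exactly the set of variables of \<open>v\<close>.\<close>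

inductive match :: "(var \<rightharpoonup> val) \<Rightarrow> val \<Rightarrow> val \<Rightarrow> bool" where
  M_Var: "match [x \<mapsto> v] (VVar x) v"
| M_Unit: "match Map.empty VUnit VUnit"
| M_Inl: "match \<sigma> v v' \<Longrightarrow> match \<sigma> (VInl v) (VInl v')"
| M_Inr: "match \<sigma> v v' \<Longrightarrow> match \<sigma> (VInr v) (VInr v')"
| M_Fold: "match \<sigma> v v' \<Longrightarrow> match \<sigma> (VFold v) (VFold v')"
| M_Pair: "match \<sigma>\<^sub>1 v v' \<Longrightarrow> match \<sigma>\<^sub>2 w w' \<Longrightarrow> dom \<sigma>\<^sub>1 \<inter> dom \<sigma>\<^sub>2 = {} \<Longrightarrow>
    match (\<sigma>\<^sub>1 ++ \<sigma>\<^sub>2) (VPair v w) (VPair v' w')"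


section \<open>Reduction\<close>

datatype ctx =
    Hole
  | CInl ctx
  | CInr ctx
  | CApp iso ctx
  | CLet pat ctx trm
  | CPairL ctx val
  | CPairR val ctx
  | CFold ctx

primrec plug :: "ctx \<Rightarrow> trm \<Rightarrow> trm" where
  "plug Hole t = t"
| "plug (CInl C) t = TmInl (plug C t)"
| "plug (CInr C) t = TmInr (plug C t)"
| "plug (CApp \<omega> C) t = TmApp \<omega> (plug C t)"
| "plug (CLet p C s) t = TmLet p (plug C t) s"
| "plug (CPairL C v) t = TmPair (plug C t) (trm_of_val v)"
| "plug (CPairR v C) t = TmPair (trm_of_val v) (plug C t)"
| "plug (CFold C) t = TmFold (plug C t)"

inductive istep :: "iso \<Rightarrow> iso \<Rightarrow> bool" where
  IS_Fix: "istep (Fix f \<omega>) (isubst f (Fix f \<omega>) \<omega>)"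

text \<open>\<open>S_Iso\<close> stands for the evaluation context \<open>C t\<close>: its hole is in iso position, where
  \<open>C = []\<close> is the only possibility.\<close>

inductive step :: "trm \<Rightarrow> trm \<Rightarrow> bool" where
  S_Ctx: "step t\<^sub>1 t\<^sub>2 \<Longrightarrow> step (plug C t\<^sub>1) (plug C t\<^sub>2)"
| S_Iso: "istep \<omega> \<omega>' \<Longrightarrow> step (TmApp \<omega> t) (TmApp \<omega>' t)"
| S_Let: "match \<sigma> (val_of_pat p) v \<Longrightarrow> step (TmLet p (trm_of_val v) t) (subst \<sigma> t)"
| S_App: "(v, e) \<in> set cs \<Longrightarrow> match \<sigma> v v' \<Longrightarrow>
    step (TmApp (Clauses cs) (trm_of_val v')) (subst \<sigma> (trm_of_exp e))"

abbreviation steps :: "trm \<Rightarrow> trm \<Rightarrow> bool" where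
  "steps \<equiv> step\<^sup>*\<^sup>*"


section \<open>Inversion\<close>

text \<open>\<open>inv_onto e acc\<close> moves the lets of \<open>e\<close> one by one, inverted, in front of \<open>acc\<close>, so that their
  order is reversed; the inverse of the clause \<open>v \<leftrightarrow> e\<close> is \<open>inv_onto e (EVal v)\<close>.\<close>

fun iso_inv :: "iso \<Rightarrow> iso"
  and inv_onto :: "exp \<Rightarrow> exp \<Rightarrow> val \<times> exp"
where
  "iso_inv (Clauses cs) = Clauses (map (\<lambda>(v, e). inv_onto e (EVal v)) cs)"
| "iso_inv (Fix f \<omega>) = Fix f (iso_inv \<omega>)"
| "iso_inv (IVar f) = IVar f"
| "inv_onto (EVal v') acc = (v', acc)"
| "inv_onto (ELet p \<omega> p' e) acc = inv_onto e (ELet p' (iso_inv \<omega>) p acc)"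

end

(* Reduction to a value is described by a big-step relation in which the let-chain of a clause
   transforms an environment whose domain is the set of live variables. By linearity every let
   consumes exactly the variables it mentions and binds names that are not live, so a run of the
   chain read backwards is a run of the inverted chain: if \<omega> maps v to w, then the inverse of \<omega>
   maps w to v. Hence, if the inverse of \<omega> maps v to u, then \<omega> maps u to v; and \<omega> is deterministic
   because two patterns of an orthogonal decomposition never match the same value. *)

theory Submission
  imports Defs
begin

section \<open>Embedding of values into terms, and predicates on the range of a map\<close>

lemma trm_of_val_inject [simp]: "trm_of_val v = trm_of_val w \<longleftrightarrow> v = w"
proof (induction v arbitrary: w)
  case VUnit then show ?case by (cases w) auto
next
  case (VVar x) then show ?case by (cases w) auto
next
  case (VInl v) then show ?case by (cases w) auto
next
  case (VInr v) then show ?case by (cases w) auto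
next
  case (VPair v1 v2) then show ?case by (cases w) auto
next
  case (VFold v) then show ?case by (cases w) auto
qed

lemma val_vars_val_of_pat [simp]: "val_vars (val_of_pat p) = pat_vars p"
  by (induction p) auto

lemma Ball_ran_map_add: "\<forall>u\<in>ran m. P u \<Longrightarrow> \<forall>u\<in>ran n. P u \<Longrightarrow> \<forall>u\<in>ran (m ++ n). P u"
  by (auto simp: ran_def)

lemma Ball_ran_restrict_map: "\<forall>u\<in>ran m. P u \<Longrightarrow> \<forall>u\<in>ran (m |` A). P u"
  by (auto dest!: ran_restrictD intro: ranI)


section \<open>Pattern matching\<close>

inductive_cases match_VVarE: "match \<sigma> (VVar x) v"
inductive_cases match_VUnitE: "match \<sigma> VUnit v"
inductive_cases match_VInlE: "match \<sigma> (VInl u) v"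
inductive_cases match_VInrE: "match \<sigma> (VInr u) v"
inductive_cases match_VFoldE: "match \<sigma> (VFold u) v"
inductive_cases match_VPairE: "match \<sigma> (VPair u w) v"

lemmas matchEs = match_VVarE match_VUnitE match_VInlE match_VInrE match_VFoldE match_VPairE

lemma match_dom: "match \<sigma> v w \<Longrightarrow> dom \<sigma> = val_vars v"
  by (induction rule: match.induct) (auto split: if_splits)

lemma match_closed:
  "match \<sigma> v w \<Longrightarrow> val_vars w = {} \<longleftrightarrow> (\<forall>u\<in>ran \<sigma>. val_vars u = {})"
proof (induction rule: match.induct)
  case (M_Pair \<sigma>1 v v' \<sigma>2 w w')
  then show ?case by (auto simp: ran_map_add)
qed (auto simp: ran_def)

lemma match_subst_unique: "match \<sigma> v w \<Longrightarrow> match \<tau> v w \<Longrightarrow> \<sigma> = \<tau>"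
proof (induction arbitrary: \<tau> rule: match.induct)
  case (M_Pair \<sigma>1 v v' \<sigma>2 w w')
  from M_Pair.prems obtain \<tau>1 \<tau>2 where "\<tau> = \<tau>1 ++ \<tau>2" "match \<tau>1 v v'" "match \<tau>2 w w'"
    by (rule match_VPairE) simp
  with M_Pair.IH show ?case by simp
qed (erule matchEs; simp)+

lemma subst_val_cong:
  "(\<And>x. x \<in> val_vars v \<Longrightarrow> \<sigma> x = \<tau> x) \<Longrightarrow> subst \<sigma> (trm_of_val v) = subst \<tau> (trm_of_val v)"
  by (induction v) auto

text \<open>Relational matching is ordinary substitution into the pattern. Hence pattern and
  substitution together determine the matched value.\<close>

lemma match_imp_subst: "match \<sigma> v w \<Longrightarrow> subst \<sigma> (trm_of_val v) = trm_of_val w"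
proof (induction rule: match.induct)
  case (M_Pair \<sigma>1 v v' \<sigma>2 w w')
  have d: "val_vars v = dom \<sigma>1" "val_vars w = dom \<sigma>2"
    using M_Pair.hyps by (simp_all add: match_dom)
  \<comment> \<open>Disjointness matters on this side only: \<open>++\<close> gives precedence to
    its right operand, so the left bindings survive only where the right map is undefined.\<close>
  have "subst (\<sigma>1 ++ \<sigma>2) (trm_of_val v) = subst \<sigma>1 (trm_of_val v)"
    using M_Pair.hyps(3) d by (intro subst_val_cong map_add_dom_app_simps(3)) auto
  moreover have "subst (\<sigma>1 ++ \<sigma>2) (trm_of_val w) = subst \<sigma>2 (trm_of_val w)"
    using d by (intro subst_val_cong map_add_dom_app_simps(1)) simp
  ultimately show ?case using M_Pair.IH by simp
qed auto

lemma match_value_unique: "match \<sigma> v w \<Longrightarrow> match \<sigma> v w' \<Longrightarrow> w = w'"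
  by (metis match_imp_subst trm_of_val_inject)

text \<open>Different injections match no common value, and variables and unit form singletons. For
  products, the projected component is compared first; the slice over it then settles the other
  one.\<close>

lemma OD_orthogonal:
  "OD A S \<Longrightarrow> v \<in> S \<Longrightarrow> w \<in> S \<Longrightarrow> match \<sigma> v u \<Longrightarrow> match \<tau> w u \<Longrightarrow> v = w"
proof (induction arbitrary: v w u \<sigma> \<tau> rule: OD.induct)
  case (OD_prod1 S A B)
  from OD_prod1.hyps(1) OD_prod1.prems(1,2) obtain v1 v2 w1 w2 where vw: "v = VPair v1 v2" "w = VPair w1 w2" by blast
  with OD_prod1.prems obtain u1 u2 \<sigma>1 \<sigma>2 \<tau>1 \<tau>2
    where m: "match \<sigma>1 v1 u1" "match \<sigma>2 v2 u2" "match \<tau>1 w1 u1" "match \<tau>2 w2 u2"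
    by (auto elim!: matchEs)
  have "v1 = w1" using OD_prod1.IH(1)[of v1 w1] m OD_prod1.prems vw by blast
  \<comment> \<open>Once the first components coincide, both second components lie in one slice, to
    which the second induction hypothesis applies.\<close>
  moreover from this have "v2 = w2" using OD_prod1.IH(2) m OD_prod1.prems vw by blast
  ultimately show ?case using vw by simp
next
  case (OD_prod2 S B A)
  from OD_prod2.hyps(1) OD_prod2.prems(1,2) obtain v1 v2 w1 w2 where vw: "v = VPair v1 v2" "w = VPair w1 w2" by blast
  with OD_prod2.prems obtain u1 u2 \<sigma>1 \<sigma>2 \<tau>1 \<tau>2
    where m: "match \<sigma>1 v1 u1" "match \<sigma>2 v2 u2" "match \<tau>1 w1 u1" "match \<tau>2 w2 u2"
    by (auto elim!: matchEs)
  have "v2 = w2" using OD_prod2.IH(1)[of v2 w2] m OD_prod2.prems vw by blast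
  moreover from this have "v1 = w1" using OD_prod2.IH(2) m OD_prod2.prems vw by blast
  ultimately show ?case using vw by simp
qed (auto elim!: matchEs)

text \<open>The type-free residue of \<open>OD_list\<close>. Distinctness is a separate conjunct
  because the second one cannot see one pattern listed twice with different right-hand
  sides.\<close>

definition orthogonal :: "val list \<Rightarrow> bool" where
  "orthogonal vs \<longleftrightarrow> distinct vs \<and>
    (\<forall>v\<in>set vs. \<forall>w\<in>set vs. \<forall>\<sigma> \<tau> u. match \<sigma> v u \<longrightarrow> match \<tau> w u \<longrightarrow> v = w)"

lemma OD_list_orthogonal: "OD_list A vs \<Longrightarrow> orthogonal vs"
  unfolding OD_list_def orthogonal_def by (metis OD_orthogonal)


section \<open>Linearity\<close>

text \<open>What remains of the typing rules without the types. Unlike typing, which forces \<open>fix\<close> to be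
  structurally recursive, this is stable under inversion. The set of variables is exact.\<close>

inductive linear_trm :: "var set \<Rightarrow> trm \<Rightarrow> bool"
  and linear_iso :: "iso \<Rightarrow> bool"
where
  L_Unit: "linear_trm {} TmUnit"
| L_Var: "linear_trm {x} (TmVar x)"
| L_Inl: "linear_trm X t \<Longrightarrow> linear_trm X (TmInl t)"
| L_Inr: "linear_trm X t \<Longrightarrow> linear_trm X (TmInr t)"
| L_Pair: "linear_trm X s \<Longrightarrow> linear_trm Y t \<Longrightarrow> X \<inter> Y = {} \<Longrightarrow> linear_trm (X \<union> Y) (TmPair s t)"
| L_Fold: "linear_trm X t \<Longrightarrow> linear_trm X (TmFold t)"
| L_App: "linear_iso \<omega> \<Longrightarrow> linear_trm X t \<Longrightarrow> linear_trm X (TmApp \<omega> t)"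
| L_Let: "linear_trm X s \<Longrightarrow> linear_trm P (trm_of_val (val_of_pat p)) \<Longrightarrow> P \<inter> Y = {} \<Longrightarrow>
    linear_trm (Y \<union> P) t \<Longrightarrow> X \<inter> Y = {} \<Longrightarrow> linear_trm (X \<union> Y) (TmLet p s t)"
| L_Clauses: "\<forall>v e. (v, e) \<in> set cs \<longrightarrow> (\<exists>X. linear_trm X (trm_of_val v) \<and> linear_trm X (trm_of_exp e)) \<Longrightarrow>
    orthogonal (map fst cs) \<Longrightarrow> orthogonal (map (exp_val \<circ> snd) cs) \<Longrightarrow> linear_iso (Clauses cs)"
| L_IVar: "linear_iso (IVar f)"
| L_Fix: "linear_iso \<omega> \<Longrightarrow> linear_iso (Fix f \<omega>)"

inductive_simps linear_simps:
  "linear_trm X TmUnit" "linear_trm X (TmVar x)" "linear_trm X (TmInl t)" "linear_trm X (TmInr t)"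
  "linear_trm X (TmPair s t)" "linear_trm X (TmFold t)" "linear_trm X (TmApp \<omega> t)"
  "linear_trm X (TmLet p s t)"
  "linear_iso (Clauses cs)" "linear_iso (IVar f)" "linear_iso (Fix f \<omega>)"

lemma linear_val_vars: "linear_trm X (trm_of_val v) \<Longrightarrow> val_vars v = X"
  by (induction v arbitrary: X) (auto simp: linear_simps)

lemma linear_pat_vars: "linear_trm X (trm_of_val (val_of_pat p)) \<Longrightarrow> pat_vars p = X"
  using linear_val_vars by fastforce

inductive_cases linear_TmPairE: "linear_trm X (TmPair s t)"

lemma linear_TmLetE:
  assumes "linear_trm X (TmLet p s t)"
  obtains Y Z where "X = Y \<union> Z" "linear_trm Y s" "linear_trm (Z \<union> pat_vars p) t"
    "linear_trm (pat_vars p) (trm_of_val (val_of_pat p))" "pat_vars p \<inter> Z = {}" "Y \<inter> Z = {}"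
  using assms
proof cases
  case (L_Let Y P Z)
  moreover from this have "P = pat_vars p" by (simp add: linear_pat_vars)
  ultimately show thesis by (intro that[of Y Z]) simp_all
qed

lemma rnest_PPair_linear:
  "xs \<noteq> [] \<Longrightarrow> distinct xs \<Longrightarrow>
    linear_trm (set xs) (trm_of_val (val_of_pat (rnest PPair (map PVar xs))))"
proof (induction xs)
  case (Cons x xs)
  then show ?case
    using L_Pair[OF L_Var[of x], of "set xs"] by (cases xs) (auto intro: L_Var simp: insert_commute)
qed simp

text \<open>Erasing types turns the domain of a context into the exact set of live variables. All
  semantic arguments below rest on this erasure rather than on typing.\<close>

lemma typing_linear:
  "trm_typing \<Delta> \<Psi> t A \<Longrightarrow> linear_trm (dom \<Delta>) t"
  "iso_typing \<Psi> \<omega> \<alpha> \<Longrightarrow> linear_iso \<omega>"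
proof (induction rule: trm_typing_iso_typing.inducts)
  case (T_Pair \<Delta>1 \<Psi> t1 A \<Delta>2 t2 B)
  then show ?case by (metis L_Pair dom_map_add sup_commute)
next
  case (T_Let \<Delta>1 \<Psi> t1 As xs \<Delta>2 t2 B)
  have "dom (\<Delta>2 ++ map_of (zip xs As)) = dom \<Delta>2 \<union> set xs"
    using T_Let by auto
  with T_Let have "linear_trm (dom \<Delta>1 \<union> dom \<Delta>2) (TmLet (rnest PPair (map PVar xs)) t1 t2)"
    by (intro L_Let[where P = "set xs"]) (auto intro: rnest_PPair_linear)
  then show ?case by (simp add: Un_commute)
next
  case (I_Clauses A B cs \<Psi>)
  then show ?case by (intro L_Clauses) (blast intro: OD_list_orthogonal)+
next
  case (T_Var A x \<Psi>)
  then show ?case using L_Var by (simp add: dom_def)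
qed (auto intro: linear_trm_linear_iso.intros)

lemma linear_subst_cong:
  "linear_trm X t \<Longrightarrow> \<forall>x\<in>X. \<sigma> x = \<tau> x \<Longrightarrow> subst \<sigma> t = subst \<tau> t"
proof (induction t arbitrary: X \<sigma> \<tau>)
  case (TmPair s t)
  from TmPair.prems(1) obtain Y Z where *: "X = Y \<union> Z" "linear_trm Y s" "linear_trm Z t"
    by (rule linear_TmPairE)
  have "subst \<sigma> s = subst \<tau> s" using TmPair.IH(1)[OF *(2)] TmPair.prems(2) *(1) by blast
  moreover have "subst \<sigma> t = subst \<tau> t" using TmPair.IH(2)[OF *(3)] TmPair.prems(2) *(1) by blast
  ultimately show ?case by simp
next
  case (TmLet p s t)
  from TmLet.prems(1) obtain Y Z
    where *: "X = Y \<union> Z" "linear_trm Y s" "linear_trm (Z \<union> pat_vars p) t"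
    by (rule linear_TmLetE)
  have "subst \<sigma> s = subst \<tau> s" using TmLet.IH(1)[OF *(2)] TmLet.prems(2) *(1) by blast
  \<comment> \<open>On the bound variables both restricted maps are undefined; elsewhere in the body
    the variable lies in \<open>Z\<close>, where the maps agree.\<close>
  moreover have "subst (\<sigma> |` (- pat_vars p)) t = subst (\<tau> |` (- pat_vars p)) t"
    using TmLet.prems(2) *(1) by (intro TmLet.IH(2)[OF *(3)]) (auto simp: restrict_map_def)
  ultimately show ?case by simp
next
  case (TmApp \<omega> t)
  then have "subst \<sigma> t = subst \<tau> t" unfolding linear_simps by blast
  then show ?case by simp
next
  case (TmInl t)
  then have "subst \<sigma> t = subst \<tau> t" unfolding linear_simps by blast
  then show ?case by simp
next
  case (TmInr t)
  then have "subst \<sigma> t = subst \<tau> t" unfolding linear_simps by blast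
  then show ?case by simp
next
  case (TmFold t)
  then have "subst \<sigma> t = subst \<tau> t" unfolding linear_simps by blast
  then show ?case by simp
qed (simp_all add: linear_simps)

lemma linear_closed_val: "val_vars v = {} \<Longrightarrow> linear_trm {} (trm_of_val v)"
proof (induction v)
  case (VPair v w)
  then show ?case using L_Pair[of "{}" _ "{}"] by simp
qed (auto intro: linear_trm_linear_iso.intros)

lemma linear_subst:
  "linear_trm X t \<Longrightarrow> \<forall>u\<in>ran \<sigma>. val_vars u = {} \<Longrightarrow> linear_trm (X - dom \<sigma>) (subst \<sigma> t)"
proof (induction t arbitrary: X \<sigma>)
  case (TmVar x)
  then show ?case
    by (auto simp: linear_simps domIff ranI split: option.splits intro!: linear_closed_val)
next
  case (TmPair s t)
  from TmPair.prems(1) obtain Y Z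
    where *: "X = Y \<union> Z" "linear_trm Y s" "linear_trm Z t" "Y \<inter> Z = {}"
    by (rule linear_TmPairE)
  have "linear_trm ((Y - dom \<sigma>) \<union> (Z - dom \<sigma>)) (subst \<sigma> (TmPair s t))"
    using TmPair.IH TmPair.prems(2) * by (auto intro!: L_Pair)
  then show ?case using *(1) by (simp add: Un_Diff)
next
  case (TmLet p s t)
  from TmLet.prems(1) obtain Y Z
    where *: "X = Y \<union> Z" "linear_trm Y s" "linear_trm (Z \<union> pat_vars p) t"
      "linear_trm (pat_vars p) (trm_of_val (val_of_pat p))" "pat_vars p \<inter> Z = {}" "Y \<inter> Z = {}"
    by (rule linear_TmLetE)
  have "\<forall>u\<in>ran (\<sigma> |` (- pat_vars p)). val_vars u = {}"
    using TmLet.prems(2) by (rule Ball_ran_restrict_map)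
  then have "linear_trm (Z \<union> pat_vars p - dom (\<sigma> |` (- pat_vars p))) (subst (\<sigma> |` (- pat_vars p)) t)"
    using TmLet.IH(2)[OF *(3)] by blast
  \<comment> \<open>The restriction keeps the bound variables out of the domain, and none of them
    lies in \<open>Z\<close>.\<close>
  moreover have "Z \<union> pat_vars p - dom (\<sigma> |` (- pat_vars p)) = (Z - dom \<sigma>) \<union> pat_vars p"
    using *(5) by (auto split: if_splits)
  ultimately have "linear_trm ((Y - dom \<sigma>) \<union> (Z - dom \<sigma>)) (subst \<sigma> (TmLet p s t))"
    using TmLet.IH(1)[OF *(2) TmLet.prems(2)] *(4-6)
    by (auto intro!: L_Let[where P = "pat_vars p"])
  then show ?case using *(1) by (simp add: Un_Diff)
qed (auto simp: linear_simps)

text \<open>A converse of \<open>match_imp_subst\<close>: linearity supplies the disjoint supports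
  that \<open>M_Pair\<close> demands. It turns a substituted value into the matching premise of an
  evaluation rule.\<close>

lemma linear_val_match:
  "linear_trm X (trm_of_val v) \<Longrightarrow> X \<subseteq> dom \<sigma> \<Longrightarrow>
    \<exists>u. subst \<sigma> (trm_of_val v) = trm_of_val u \<and> match (\<sigma> |` X) v u"
proof (induction v arbitrary: X)
  case VUnit
  then show ?case by (auto simp: linear_simps intro: M_Unit exI[of _ VUnit])
next
  case (VVar x)
  then obtain u where u: "X = {x}" "\<sigma> x = Some u" by (auto simp: linear_simps)
  then have "\<sigma> |` X = [x \<mapsto> u]" by (auto simp: restrict_map_def)
  then have "match (\<sigma> |` X) (VVar x) u" using M_Var by metis
  with u(2) show ?case by simp
next
  case (VInl v)
  then obtain u where "subst \<sigma> (trm_of_val v) = trm_of_val u" "match (\<sigma> |` X) v u"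
    by (auto simp: linear_simps)
  then show ?case by (auto intro!: exI[of _ "VInl u"] M_Inl)
next
  case (VInr v)
  then obtain u where "subst \<sigma> (trm_of_val v) = trm_of_val u" "match (\<sigma> |` X) v u"
    by (auto simp: linear_simps)
  then show ?case by (auto intro!: exI[of _ "VInr u"] M_Inr)
next
  case (VFold v)
  then obtain u where "subst \<sigma> (trm_of_val v) = trm_of_val u" "match (\<sigma> |` X) v u"
    by (auto simp: linear_simps)
  then show ?case by (auto intro!: exI[of _ "VFold u"] M_Fold)
next
  case (VPair v w)
  from VPair.prems(1) obtain Y Z
    where *: "X = Y \<union> Z" "linear_trm Y (trm_of_val v)" "linear_trm Z (trm_of_val w)" "Y \<inter> Z = {}"
    unfolding trm_of_val.simps by (rule linear_TmPairE)
  obtain v' where v': "subst \<sigma> (trm_of_val v) = trm_of_val v'" "match (\<sigma> |` Y) v v'"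
    using VPair.IH(1)[OF *(2)] VPair.prems(2) *(1) by auto
  obtain w' where w': "subst \<sigma> (trm_of_val w) = trm_of_val w'" "match (\<sigma> |` Z) w w'"
    using VPair.IH(2)[OF *(3)] VPair.prems(2) *(1) by auto
  have "\<sigma> |` X = (\<sigma> |` Y) ++ (\<sigma> |` Z)"
    using *(1) by (auto simp: fun_eq_iff map_add_def restrict_map_def split: option.splits)
  moreover have "match ((\<sigma> |` Y) ++ (\<sigma> |` Z)) (VPair v w) (VPair v' w')"
    using v' w' *(4) by (intro M_Pair) auto
  ultimately show ?case using v' w' by (auto intro!: exI[of _ "VPair v' w'"])
qed

section \<open>Substitution of isos for iso-variables\<close>

lemma exp_val_isubst [simp]: "exp_val (isubst_exp f \<phi> e) = exp_val e"
  by (induction e rule: exp_val.induct) auto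

text \<open>Only the isos inside lets change, so patterns and final values, and with them
  orthogonality, are untouched.\<close>

lemma linear_isubst:
  assumes "linear_iso \<phi>"
  shows "linear_iso \<omega> \<Longrightarrow> linear_iso (isubst f \<phi> \<omega>)"
    and "linear_trm X (trm_of_exp e) \<Longrightarrow> linear_trm X (trm_of_exp (isubst_exp f \<phi> e))"
  using assms
proof (induction f \<phi> \<omega> and f \<phi> e arbitrary: and X rule: isubst_isubst_exp.induct)
  case (1 f \<phi> cs)
  have "map fst (map (\<lambda>(v, e). (v, isubst_exp f \<phi> e)) cs) = map fst cs"
    "map (exp_val \<circ> snd) (map (\<lambda>(v, e). (v, isubst_exp f \<phi> e)) cs) = map (exp_val \<circ> snd) cs"
    by auto
  with 1 show ?case by (fastforce simp: linear_simps simp del: map_map)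
next
  case (5 f \<phi> p \<omega> p' e)
  then show ?case unfolding isubst_exp.simps trm_of_exp.simps linear_simps by blast
qed (auto simp: linear_simps)


section \<open>Inversion\<close>

lemma fst_inv_onto [simp]: "fst (inv_onto e acc) = exp_val e"
  by (induction e arbitrary: acc rule: exp_val.induct) auto

lemma exp_val_inv_onto [simp]: "exp_val (snd (inv_onto e acc)) = exp_val acc"
  by (induction e arbitrary: acc rule: exp_val.induct) auto

text \<open>The second equation is the analogue of \<open>rev (rev e @ acc) = rev acc @ e\<close>,
  with \<open>inv_onto\<close> as reversal onto an accumulator. For \<open>acc = EVal v\<close> its
  right-hand side is the original clause.\<close>

lemma iso_inv_involutive:
  "iso_inv (iso_inv \<omega>) = \<omega>"
  "inv_onto (snd (inv_onto e acc)) (EVal (exp_val e)) = inv_onto acc e"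
proof (induction \<omega> and e acc rule: iso_inv_inv_onto.induct)
  case (1 cs)
  have "(\<lambda>(v, e). inv_onto e (EVal v)) (inv_onto e (EVal v)) = (v, e)" if "(v, e) \<in> set cs" for v e
    using 1[OF that refl] by (simp add: case_prod_beta)
  then show ?case by (auto intro!: map_idI)
qed auto

text \<open>This makes the unfolding of an inverted \<open>Fix\<close> the inverse of the unfolding.
  The accumulator holds lets that are already inverted, so it receives the inverse of
  \<phi>.\<close>

lemma iso_inv_isubst:
  "iso_inv (isubst f \<phi> \<omega>) = isubst f (iso_inv \<phi>) (iso_inv \<omega>)"
  "inv_onto (isubst_exp f \<phi> e) (isubst_exp f (iso_inv \<phi>) acc) =
    apsnd (isubst_exp f (iso_inv \<phi>)) (inv_onto e acc)"
proof (induction f \<phi> \<omega> and f \<phi> e arbitrary: and acc rule: isubst_isubst_exp.induct)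
  case (1 f \<phi> cs)
  have "inv_onto (isubst_exp f \<phi> e) (EVal v) =
      apsnd (isubst_exp f (iso_inv \<phi>)) (inv_onto e (EVal v))" if "(v, e) \<in> set cs" for v e
    using 1[OF that refl, of "EVal v"] by simp
  then show ?case by (auto simp: apsnd_def map_prod_def)
next
  case (5 f \<phi> p \<omega> p' e)
  then show ?case using 5(2)[of "ELet p' (iso_inv \<omega>) p acc"] by simp
qed auto

text \<open>\<open>X\<close> is the set of variables live at the boundary between the lets still to
  be moved and the accumulator; both sides consume exactly these. Inversion exchanges the two
  orthogonality conditions of a clause list.\<close>

lemma linear_inv:
  "linear_iso \<omega> \<Longrightarrow> linear_iso (iso_inv \<omega>)"
  "linear_trm X (trm_of_exp e) \<Longrightarrow> linear_trm X (trm_of_exp acc) \<Longrightarrow>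
    \<exists>Y. linear_trm Y (trm_of_val (exp_val e)) \<and> linear_trm Y (trm_of_exp (snd (inv_onto e acc)))"
proof (induction \<omega> and e acc arbitrary: and X rule: iso_inv_inv_onto.induct)
  case (1 cs)
  have "\<exists>X. linear_trm X (trm_of_val v') \<and> linear_trm X (trm_of_exp e')"
    if "(v', e') \<in> set (map (\<lambda>(v, e). inv_onto e (EVal v)) cs)" for v' e'
  proof -
    from that obtain v e where ve: "(v, e) \<in> set cs" "inv_onto e (EVal v) = (v', e')" by auto
    with 1(2) obtain X where "linear_trm X (trm_of_val v)" "linear_trm X (trm_of_exp e)"
      by (auto simp: linear_simps)
    moreover have "v' = exp_val e" "e' = snd (inv_onto e (EVal v))"
      using ve(2) fst_inv_onto[of e "EVal v"] by auto
    ultimately show ?thesis using 1(1)[OF ve(1) refl, of X] by simp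
  qed
  moreover have "map fst (map (\<lambda>(v, e). inv_onto e (EVal v)) cs) = map (exp_val \<circ> snd) cs"
    "map (exp_val \<circ> snd) (map (\<lambda>(v, e). inv_onto e (EVal v)) cs) = map fst cs"
    by (auto simp: case_prod_beta)
  ultimately show ?case using 1(2) by (simp add: linear_simps del: map_map set_map)
next
  case (5 p \<omega> p' e acc)
  then obtain Y Z P where *: "X = Y \<union> Z" "linear_iso \<omega>" "linear_trm Y (trm_of_val (val_of_pat p'))"
      "linear_trm P (trm_of_val (val_of_pat p))" "linear_trm (Z \<union> P) (trm_of_exp e)"
      "P \<inter> Z = {}" "Y \<inter> Z = {}"
    by (auto simp: linear_simps)
  \<comment> \<open>The inverted let consumes \<open>P\<close> and binds \<open>Y\<close>, so the
    boundary moves from \<open>Y \<union> Z\<close> to \<open>Z \<union> P\<close>.\<close>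
  have "linear_trm (P \<union> Z) (trm_of_exp (ELet p' (iso_inv \<omega>) p acc))"
    using * 5 by (auto intro!: L_Let[where P = Y] L_App simp: Un_commute)
  then show ?case using 5(2)[of "Z \<union> P"] * by (simp add: Un_commute)
qed (auto simp: linear_simps)


section \<open>Big-step semantics\<close>

text \<open>\<open>E_Let\<close> removes the consumed bindings before adding the new ones, so a let
  may reuse a name that it consumes. Its freshness premise prevents live bindings from being
  overwritten, which keeps the step reversible. The exact support in \<open>match\<close> makes
  \<open>E_Val\<close> consume everything that is left.\<close>

inductive eval_iso :: "iso \<Rightarrow> val \<Rightarrow> val \<Rightarrow> bool"
  and eval_exp :: "(var \<rightharpoonup> val) \<Rightarrow> exp \<Rightarrow> val \<Rightarrow> bool"
where
  E_Fix: "eval_iso (isubst f (Fix f \<omega>) \<omega>) v w \<Longrightarrow> eval_iso (Fix f \<omega>) v w"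
| E_Clauses: "(u, e) \<in> set cs \<Longrightarrow> match \<sigma> u v \<Longrightarrow> eval_exp \<sigma> e w \<Longrightarrow> eval_iso (Clauses cs) v w"
| E_Val: "match \<sigma> v w \<Longrightarrow> eval_exp \<sigma> (EVal v) w"
| E_Let: "match (\<sigma> |` pat_vars p') (val_of_pat p') a \<Longrightarrow> eval_iso \<omega> a b \<Longrightarrow>
    match \<tau> (val_of_pat p) b \<Longrightarrow> pat_vars p \<inter> (dom \<sigma> - pat_vars p') = {} \<Longrightarrow>
    eval_exp (\<sigma> |` (- pat_vars p') ++ \<tau>) e w \<Longrightarrow> eval_exp \<sigma> (ELet p \<omega> p' e) w"

inductive_cases eval_FixE: "eval_iso (Fix f \<omega>) v w"
inductive_cases eval_ClausesE: "eval_iso (Clauses cs) v w"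
inductive_cases eval_EValE: "eval_exp \<sigma> (EVal v) w"
inductive_cases eval_ELetE: "eval_exp \<sigma> (ELet p \<omega> p' e) w"

text \<open>In the second part, the inverted lets of \<open>e\<close> carry the final environment
  \<tau> back to \<sigma>, from where \<open>acc\<close> continues to \<open>u\<close>.\<close>

lemma eval_inv:
  "eval_iso \<omega> v w \<Longrightarrow> eval_iso (iso_inv \<omega>) w v"
  "eval_exp \<sigma> e w \<Longrightarrow> eval_exp \<sigma> acc u \<Longrightarrow>
    \<exists>\<tau>. match \<tau> (exp_val e) w \<and> eval_exp \<tau> (snd (inv_onto e acc)) u"
proof (induction arbitrary: and acc u rule: eval_iso_eval_exp.inducts)
  case (E_Fix f \<omega> v w)
  then show ?case by (auto simp: iso_inv_isubst intro: eval_iso_eval_exp.E_Fix)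
next
  case (E_Clauses u e cs \<sigma> v w)
  \<comment> \<open>The accumulator is the left pattern itself: matching it against the input, read
    by \<open>E_Val\<close>, rebuilds that input.\<close>
  from E_Clauses.IH[OF eval_iso_eval_exp.E_Val[OF E_Clauses.hyps(2)]] obtain \<tau>
    where \<tau>: "match \<tau> (exp_val e) w" "eval_exp \<tau> (snd (inv_onto e (EVal u))) v" by blast
  have "inv_onto e (EVal u) = (exp_val e, snd (inv_onto e (EVal u)))"
    by (simp add: prod_eq_iff)
  then have "(exp_val e, snd (inv_onto e (EVal u))) \<in> set (map (\<lambda>(v, e). inv_onto e (EVal v)) cs)"
    using E_Clauses.hyps(1) by force
  then show ?case using \<tau> by (auto intro: eval_iso_eval_exp.E_Clauses simp del: set_map)
next
  case (E_Let \<sigma> p' a \<omega> b \<tau> p e w)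
  let ?\<rho> = "\<sigma> |` (- pat_vars p') ++ \<tau>"
  have d: "dom \<tau> = pat_vars p" "dom (\<sigma> |` pat_vars p') = pat_vars p'"
    using E_Let.hyps match_dom by fastforce+
  have "?\<rho> |` pat_vars p = \<tau>"
    using d(1) by (auto simp: fun_eq_iff map_add_def restrict_map_def domIff split: option.splits)
  \<comment> \<open>Undoing the let restores \<sigma>. Outside \<open>pat_vars p'\<close>, freshness
    ensures that \<sigma> was undefined on the variables of \<open>p\<close>.\<close>
  moreover have "?\<rho> |` (- pat_vars p) ++ \<sigma> |` pat_vars p' = \<sigma>"
  proof
    fix x
    show "(?\<rho> |` (- pat_vars p) ++ \<sigma> |` pat_vars p') x = \<sigma> x"
    proof (cases "x \<in> pat_vars p'")
      case True
      then have "x \<in> dom (\<sigma> |` pat_vars p')" using d(2) by simp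
      then show ?thesis using True by (simp add: map_add_dom_app_simps)
    next
      case False
      have "x \<in> pat_vars p \<Longrightarrow> \<sigma> x = None" using False E_Let.hyps(4) by auto
      moreover have "x \<notin> pat_vars p \<Longrightarrow> \<tau> x = None" using d(1) by auto
      ultimately show ?thesis using False
        by (auto simp: map_add_def restrict_map_def split: option.splits)
    qed
  qed
  moreover have "pat_vars p' \<inter> (dom ?\<rho> - pat_vars p) = {}" using d(1) by auto
  ultimately have "eval_exp ?\<rho> (ELet p' (iso_inv \<omega>) p acc) u"
    using E_Let by (intro eval_iso_eval_exp.E_Let[where \<tau> = "\<sigma> |` pat_vars p'"]) auto
  then show ?case using E_Let.IH(2) by simp
qed auto

text \<open>Orthogonality selects the clause, and then pattern and value determine the substitution.
  Linearity is carried along since it supplies orthogonality for every iso met, including unfoldings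
  of \<open>Fix\<close>.\<close>

lemma eval_deterministic:
  "eval_iso \<omega> v w \<Longrightarrow> linear_iso \<omega> \<Longrightarrow> eval_iso \<omega> v w' \<Longrightarrow> w' = w"
  "eval_exp \<sigma> e w \<Longrightarrow> linear_trm X (trm_of_exp e) \<Longrightarrow> eval_exp \<sigma> e w' \<Longrightarrow> w' = w"
proof (induction arbitrary: w' and X w' rule: eval_iso_eval_exp.inducts)
  case (E_Fix f \<omega> v w)
  have "linear_iso (isubst f (Fix f \<omega>) \<omega>)"
    using linear_isubst(1)[OF E_Fix.prems(1)] E_Fix.prems(1) by (simp add: linear_simps)
  moreover have "eval_iso (isubst f (Fix f \<omega>) \<omega>) v w'"
    using E_Fix.prems(2) by (rule eval_FixE)
  ultimately show ?case by (rule E_Fix.IH)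
next
  case (E_Clauses u e cs \<sigma> v w)
  from E_Clauses.prems(2) obtain u' e' \<sigma>'
    where *: "(u', e') \<in> set cs" "match \<sigma>' u' v" "eval_exp \<sigma>' e' w'"
    by (rule eval_ClausesE)
  have o: "orthogonal (map fst cs)" using E_Clauses.prems(1) by (simp add: linear_simps)
  then have "u = u'"
    using *(1,2) E_Clauses.hyps(1,2) unfolding orthogonal_def by (metis fst_conv image_eqI set_map)
  \<comment> \<open>Equal patterns give equal right-hand sides because distinct patterns make the
    clause list a functional association list.\<close>
  with o *(1) E_Clauses.hyps(1) have "e = e'"
    by (auto simp: orthogonal_def dest: eq_key_imp_eq_value)
  moreover have "\<sigma> = \<sigma>'" using *(2) E_Clauses.hyps(2) \<open>u = u'\<close> match_subst_unique by blast
  moreover obtain X where "linear_trm X (trm_of_exp e)"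
    using E_Clauses.prems(1) E_Clauses.hyps(1) by (auto simp: linear_simps)
  ultimately show ?case using E_Clauses.IH *(3) by blast
next
  case (E_Val \<sigma> v w)
  from E_Val.prems(2) have "match \<sigma> v w'" by (rule eval_EValE)
  then show ?case using E_Val.hyps match_value_unique by blast
next
  case (E_Let \<sigma> p' a \<omega> b \<tau> p e w)
  from E_Let.prems(2) obtain a' b' \<tau>'
    where *: "match (\<sigma> |` pat_vars p') (val_of_pat p') a'" "eval_iso \<omega> a' b'"
      "match \<tau>' (val_of_pat p) b'" "eval_exp (\<sigma> |` (- pat_vars p') ++ \<tau>') e w'"
    by (rule eval_ELetE)
  from E_Let.prems(1) obtain Y where lin: "linear_iso \<omega>" "linear_trm Y (trm_of_exp e)"
    by (auto simp: linear_simps)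
  have "a' = a" using *(1) E_Let.hyps(1) match_value_unique by blast
  then have "b' = b" using E_Let.IH(1) lin(1) *(2) by blast
  then have "\<tau>' = \<tau>" using *(3) E_Let.hyps(3) match_subst_unique by blast
  then show ?case using E_Let.IH(2) lin(2) *(4) by blast
qed

lemma eval_closed:
  "eval_iso \<omega> v w \<Longrightarrow> val_vars v = {} \<Longrightarrow> val_vars w = {}"
  "eval_exp \<sigma> e w \<Longrightarrow> \<forall>u\<in>ran \<sigma>. val_vars u = {} \<Longrightarrow> val_vars w = {}"
proof (induction rule: eval_iso_eval_exp.inducts)
  case (E_Let \<sigma> p' a \<omega> b \<tau> p e w)
  have ran: "\<forall>u\<in>ran (\<sigma> |` Y). val_vars u = {}" for Y
    using E_Let.prems by (rule Ball_ran_restrict_map)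
  then have "val_vars a = {}" using match_closed[OF E_Let.hyps(1)] by simp
  then have "val_vars b = {}" by (rule E_Let.IH(1))
  then have "\<forall>u\<in>ran \<tau>. val_vars u = {}" using match_closed[OF E_Let.hyps(3)] by simp
  with ran have "\<forall>u\<in>ran (\<sigma> |` (- pat_vars p') ++ \<tau>). val_vars u = {}" by (rule Ball_ran_map_add)
  then show ?case by (rule E_Let.IH(2))
qed (auto simp: match_closed)

text \<open>Variables evaluate to themselves, so that every embedded value, open or closed,
  evaluates exactly to itself.\<close>

inductive eval_trm :: "trm \<Rightarrow> val \<Rightarrow> bool" where
  ET_Unit: "eval_trm TmUnit VUnit"
| ET_Var: "eval_trm (TmVar x) (VVar x)"
| ET_Inl: "eval_trm t v \<Longrightarrow> eval_trm (TmInl t) (VInl v)"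
| ET_Inr: "eval_trm t v \<Longrightarrow> eval_trm (TmInr t) (VInr v)"
| ET_Pair: "eval_trm s v \<Longrightarrow> eval_trm t w \<Longrightarrow> eval_trm (TmPair s t) (VPair v w)"
| ET_Fold: "eval_trm t v \<Longrightarrow> eval_trm (TmFold t) (VFold v)"
| ET_App: "eval_trm t v \<Longrightarrow> eval_iso \<omega> v w \<Longrightarrow> eval_trm (TmApp \<omega> t) w"
| ET_Let: "eval_trm s v \<Longrightarrow> match \<sigma> (val_of_pat p) v \<Longrightarrow> eval_trm (subst \<sigma> t) w \<Longrightarrow>
    eval_trm (TmLet p s t) w"

inductive_simps eval_trm_simps:
  "eval_trm TmUnit v" "eval_trm (TmVar x) v" "eval_trm (TmInl t) v" "eval_trm (TmInr t) v"
  "eval_trm (TmPair s t) v" "eval_trm (TmFold t) v" "eval_trm (TmApp \<omega> t) v"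
  "eval_trm (TmLet p s t) v"

lemma eval_trm_of_val [simp]: "eval_trm (trm_of_val v) w \<longleftrightarrow> w = v"
  by (induction v arbitrary: w) (auto simp: eval_trm_simps)


section \<open>Reduction\<close>

lemma subst_closed_val: "val_vars v = {} \<Longrightarrow> subst \<sigma> (trm_of_val v) = trm_of_val v"
  by (induction v) auto

text \<open>Closed values inserted by \<sigma> are immune to \<tau>, so \<sigma> takes precedence in
  the merged map.\<close>

lemma subst_subst:
  "\<forall>u\<in>ran \<sigma>. val_vars u = {} \<Longrightarrow> subst \<tau> (subst \<sigma> t) = subst (\<tau> ++ \<sigma>) t"
proof (induction t arbitrary: \<sigma> \<tau>)
  case (TmVar x)
  then show ?case by (auto simp: ranI subst_closed_val split: option.splits)
next
  case (TmLet p s t)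
  have "\<forall>u\<in>ran (\<sigma> |` (- pat_vars p)). val_vars u = {}"
    using TmLet.prems by (rule Ball_ran_restrict_map)
  moreover have "\<tau> |` (- pat_vars p) ++ \<sigma> |` (- pat_vars p) = (\<tau> ++ \<sigma>) |` (- pat_vars p)"
    by (auto simp: fun_eq_iff map_add_def restrict_map_def split: option.splits)
  ultimately show ?case using TmLet by simp
qed auto

text \<open>The bridge from terms, where a let substitutes into its body, to environments, where it
  updates the live bindings.\<close>

lemma eval_subst_exp:
  "linear_trm X (trm_of_exp e) \<Longrightarrow> dom \<sigma> = X \<Longrightarrow> \<forall>u\<in>ran \<sigma>. val_vars u = {} \<Longrightarrow>
    eval_trm (subst \<sigma> (trm_of_exp e)) w \<Longrightarrow> eval_exp \<sigma> e w"
proof (induction e arbitrary: X \<sigma> rule: trm_of_exp.induct)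
  case (1 v)
  obtain u where u: "subst \<sigma> (trm_of_val v) = trm_of_val u" "match (\<sigma> |` X) v u"
    using linear_val_match[of X v \<sigma>] 1(1,2) by auto
  have "\<sigma> |` X = \<sigma>" using 1(2) by (auto simp: fun_eq_iff restrict_map_def domIff)
  with u(2) have "match \<sigma> v u" by metis
  moreover have "w = u" using 1(4) unfolding trm_of_exp.simps u(1) by simp
  ultimately show ?case by (blast intro: E_Val)
next
  case (2 p \<omega> p' e)
  from 2(2) obtain Y Z where Y: "X = Y \<union> Z" "linear_trm Y (TmApp \<omega> (trm_of_val (val_of_pat p')))"
      "linear_trm (Z \<union> pat_vars p) (trm_of_exp e)" "pat_vars p \<inter> Z = {}" "Y \<inter> Z = {}"
    unfolding trm_of_exp.simps by (rule linear_TmLetE)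
  moreover from Y(2) have "linear_trm Y (trm_of_val (val_of_pat p'))" by (simp add: linear_simps)
  moreover from this have "Y = pat_vars p'" by (simp add: linear_pat_vars)
  ultimately have *: "X = pat_vars p' \<union> Z" "linear_trm (pat_vars p') (trm_of_val (val_of_pat p'))"
      "linear_trm (Z \<union> pat_vars p) (trm_of_exp e)" "pat_vars p \<inter> Z = {}" "pat_vars p' \<inter> Z = {}"
    by simp_all
  from linear_val_match[OF *(2), of \<sigma>] *(1) 2(3) obtain a
    where a: "subst \<sigma> (trm_of_val (val_of_pat p')) = trm_of_val a"
      "match (\<sigma> |` pat_vars p') (val_of_pat p') a" by auto
  with 2(5) obtain b \<tau> where b: "eval_iso \<omega> a b" "match \<tau> (val_of_pat p) b"
      "eval_trm (subst \<tau> (subst (\<sigma> |` (- pat_vars p)) (trm_of_exp e))) w"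
    by (auto simp: eval_trm_simps)
  have ran: "\<forall>u\<in>ran (\<sigma> |` Y). val_vars u = {}" for Y
    using 2(4) by (rule Ball_ran_restrict_map)
  then have "val_vars a = {}" using match_closed[OF a(2)] by simp
  then have "val_vars b = {}" using b(1) eval_closed(1) by blast
  then have ran\<tau>: "\<forall>u\<in>ran \<tau>. val_vars u = {}" using match_closed[OF b(2)] by simp
  let ?\<rho> = "\<sigma> |` (- pat_vars p') ++ \<tau>"
  have dom\<tau>: "dom \<tau> = pat_vars p" using b(2) match_dom by fastforce
  \<comment> \<open>The maps can differ only on consumed variables of \<open>p'\<close> that
    \<open>p\<close> does not rebind; by linearity the body does not mention these. On
    \<open>pat_vars p\<close> both are \<tau>, on \<open>Z\<close> both are \<sigma>.\<close>
  have "subst (\<tau> ++ \<sigma> |` (- pat_vars p)) (trm_of_exp e) = subst ?\<rho> (trm_of_exp e)"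
  proof (rule linear_subst_cong[OF *(3)], rule ballI)
    fix x assume "x \<in> Z \<union> pat_vars p"
    then show "(\<tau> ++ \<sigma> |` (- pat_vars p)) x = ?\<rho> x"
      using *(4,5) dom\<tau>
      by (auto simp: map_add_def restrict_map_def domIff split: option.splits)
  qed
  then have "eval_trm (subst ?\<rho> (trm_of_exp e)) w"
    using b(3) ran by (simp add: subst_subst)
  moreover have "dom ?\<rho> = Z \<union> pat_vars p" using dom\<tau> *(1,5) 2(3) by auto
  moreover have "\<forall>u\<in>ran ?\<rho>. val_vars u = {}"
    using ran ran\<tau> by (rule Ball_ran_map_add)
  ultimately have "eval_exp ?\<rho> e w" using 2(1)[OF *(3)] by blast
  moreover have "pat_vars p \<inter> (dom \<sigma> - pat_vars p') = {}" using *(1,4) 2(3) by auto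
  ultimately show ?case using a(2) b(1,2) by (auto intro: E_Let)
qed

section \<open>Evaluation contexts and single reduction steps\<close>

lemma linear_plugD: "linear_trm {} (plug C t) \<Longrightarrow> linear_trm {} t"
  by (induction C) (auto simp: linear_simps)

lemma linear_plug_replace:
  "linear_trm {} (plug C s) \<Longrightarrow> linear_trm {} t \<Longrightarrow> linear_trm {} (plug C t)"
  by (induction C) (auto simp: linear_simps)

lemma eval_plug_replace:
  "(\<And>w. eval_trm t w \<Longrightarrow> eval_trm s w) \<Longrightarrow> eval_trm (plug C t) w \<Longrightarrow> eval_trm (plug C s) w"
  by (induction C arbitrary: w) (auto simp: eval_trm_simps)

text \<open>Linearity travels forward along a step and evaluation results travel backward. A
  reduction ending in a value, which evaluates to itself, thus yields an evaluation of its starting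
  term, whatever order the steps were taken in.\<close>

lemma step_backward:
  "step s t \<Longrightarrow> linear_trm {} s \<Longrightarrow> linear_trm {} t \<and> (\<forall>w. eval_trm t w \<longrightarrow> eval_trm s w)"
proof (induction rule: step.induct)
  case (S_Ctx s t C)
  then show ?case
    using linear_plugD linear_plug_replace eval_plug_replace by meson
next
  case (S_Iso \<omega> \<omega>' t)
  then obtain f \<phi> where *: "\<omega> = Fix f \<phi>" "\<omega>' = isubst f (Fix f \<phi>) \<phi>" by (auto elim: istep.cases)
  have "linear_iso (Fix f \<phi>)" using S_Iso.prems *(1) by (simp add: linear_simps)
  then have "linear_iso \<omega>'" using linear_isubst(1) *(2) by (simp add: linear_simps)
  with * S_Iso.prems show ?case by (auto simp: linear_simps eval_trm_simps intro: E_Fix)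
next
  case (S_Let \<sigma> p v t)
  then have *: "linear_trm {} (trm_of_val v)" "linear_trm (pat_vars p) t"
    by (auto simp: linear_simps dest: linear_pat_vars)
  have "\<forall>u\<in>ran \<sigma>. val_vars u = {}"
    using match_closed[OF S_Let.hyps] linear_val_vars[OF *(1)] by simp
  moreover have "dom \<sigma> = pat_vars p" using S_Let.hyps match_dom by fastforce
  ultimately have "linear_trm {} (subst \<sigma> t)" using linear_subst[OF *(2)] by fastforce
  with S_Let.hyps show ?case by (auto intro: ET_Let)
next
  case (S_App v e cs \<sigma> v')
  then have closed: "linear_trm {} (trm_of_val v')" by (simp add: linear_simps)
  from S_App obtain X where *: "linear_trm X (trm_of_val v)" "linear_trm X (trm_of_exp e)"
    by (auto simp: linear_simps)
  have ran: "\<forall>u\<in>ran \<sigma>. val_vars u = {}"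
    using match_closed[OF S_App.hyps(2)] linear_val_vars[OF closed] by simp
  have dom: "dom \<sigma> = X" using match_dom[OF S_App.hyps(2)] linear_val_vars[OF *(1)] by simp
  have "linear_trm {} (subst \<sigma> (trm_of_exp e))" using linear_subst[OF *(2) ran] dom by simp
  moreover have "eval_trm (TmApp (Clauses cs) (trm_of_val v')) w"
    if "eval_trm (subst \<sigma> (trm_of_exp e)) w" for w
    using eval_subst_exp[OF *(2) dom ran that] S_App.hyps by (auto intro: ET_App E_Clauses)
  ultimately show ?case by blast
qed

lemma steps_imp_eval:
  assumes "steps t (trm_of_val w)" and "linear_trm {} t"
  shows "eval_trm t w"
  using assms by (induction rule: converse_rtranclp_induct) (use step_backward in auto)

theorem mainTheorem7:
  fixes \<omega> :: iso and A B :: ty and v v' :: val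
  assumes "iso_typing None \<omega> (A \<leftrightarrow> B)"
    and "trm_typing Map.empty None (trm_of_val v) B"
    and "steps (TmApp \<omega> (TmApp (iso_inv \<omega>) (trm_of_val v))) (trm_of_val v')"
  shows "v = v'"
proof -
  have \<omega>: "linear_iso \<omega>" using typing_linear(2)[OF assms(1)] .
  have "linear_trm {} (trm_of_val v)" using typing_linear(1)[OF assms(2)] by simp
  then have "linear_trm {} (TmApp \<omega> (TmApp (iso_inv \<omega>) (trm_of_val v)))"
    using \<omega> by (intro L_App linear_inv)
  from steps_imp_eval[OF assms(3) this] obtain u
    where u: "eval_iso (iso_inv \<omega>) v u" "eval_iso \<omega> u v'"
    by (auto simp: eval_trm_simps)
  \<comment> \<open>Reversing the run of the inverse gives a run of the double inverse, which is
    \<omega> itself.\<close>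
  have "eval_iso \<omega> u v" using eval_inv(1)[OF u(1)] by (simp add: iso_inv_involutive)
  then show ?thesis using eval_deterministic(1)[OF u(2) \<omega>] by blast
qed

end
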